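(* Let $\mathcal{P}\subset S^d$ be a spherical polytope with vertices $P_1,\dots,P_m$. Let $(I,J)$ and $(I',J')$ be two partitions of $\{1,\dots,m\}$ into two nonempty disjoint subsets, and let $\mathcal{P}_1,\mathcal{P}_2,\mathcal{P}_3,\mathcal{P}_4$ be the spherical polytopes with vertex sets $\{P_i\}_{i\in I}$, $\{P_j\}_{j\in J}$, $\{P_i\}_{i\in I'}$, $\{P_j\}_{j\in J'}$ respectively. Suppose $\mathcal{P}_1\cap(-\mathcal{P}_2)=\emptyset$ and $\mathcal{P}_3\cap(-\mathcal{P}_4)=\emptyset$. Then the pairs $(\mathcal{P}_1,-\mathcal{P}_2)$ and $(\mathcal{P}_3,-\mathcal{P}_4)$ have the same separation center set, i.e. $$\mathcal{C}(\mathcal{P}_1,-\mathcal{P}_2)\cup\mathcal{C}(-\mathcal{P}_2,\mathcal{P}_1)=\mathcal{C}(\mathcal{P}_3,-\mathcal{P}_4)\cup\mathcal{C}(-\mathcal{P}_4,\mathcal{P}_3).$$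
   Context: $S^d$ is the unit sphere of $\mathbb{R}^{d+1}$ with scalar product $P\cdot Q$, and $H(P)=\{Q\in S^d\mid P\cdot Q\geq0\}$. A set $W\subset S^d$ is hemispherical if $W\cap H(P)=\emptyset$ for some $P\in S^d$. The spherical convex hull of a hemispherical set $W$ is the set of all $\frac{\sum_i\lambda_iQ_i}{\|\sum_i\lambda_iQ_i\|}$ for finite sums with $\lambda_i\ge0$, $\sum_i\lambda_i=1$, $Q_i\in W$. A spherical polytope is the spherical convex hull of a nonempty finite hemispherical set; its vertices are the points of the unique minimal such finite set. For $W_1,W_2\subset S^d$, $$\mathcal{C}(W_1,W_2)=\{P\in S^d\mid P\cdot Q\ge0\ \text{for any }Q\in W_1\ \text{and}\ P\cdot R\le0\ \text{for any }R\in W_2\},$$ and $\mathcal{C}(W_1,W_2)\cup\mathcal{C}(W_2,W_1)$ is the separation center set of $W_1,W_2$. *)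

theory Defs
  imports "HOL-Analysis.Analysis"
begin

text \<open>
  The sphere of dimension \<open>d\<close> is \<open>sphere 0 1\<close> in the type \<open>real ^ 'n\<close>, where \<open>CARD('n) = d + 1\<close>.
\<close>

definition closed_hemisphere :: "real ^ 'n \<Rightarrow> (real ^ 'n) set" where
  "closed_hemisphere P = {Q \<in> sphere 0 1. P \<bullet> Q \<ge> 0}"

definition hemispherical :: "(real ^ 'n) set \<Rightarrow> bool" where
  "hemispherical W \<longleftrightarrow>
     W \<subseteq> sphere 0 1 \<and> (\<exists>P \<in> sphere 0 1. W \<inter> closed_hemisphere P = {})"

text \<open>Only meaningful for hemispherical sets: there the normalised sums are nonzero.\<close>

definition spherical_hull :: "(real ^ 'n) set \<Rightarrow> (real ^ 'n) set" where
  "spherical_hull W =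
     {(\<Sum>i=1..k. l i *\<^sub>R Q i) /\<^sub>R norm (\<Sum>i=1..k. l i *\<^sub>R Q i) | (k::nat) l Q.
        (\<forall>i\<in>{1..k}. l i \<ge> 0 \<and> Q i \<in> W) \<and> (\<Sum>i=1..k. l i) = 1}"

definition spherically_generates :: "(real ^ 'n) set \<Rightarrow> (real ^ 'n) set \<Rightarrow> bool" where
  "spherically_generates V W \<longleftrightarrow>
     finite V \<and> V \<noteq> {} \<and> hemispherical V \<and> W = spherical_hull V"

definition spherical_polytope :: "(real ^ 'n) set \<Rightarrow> bool" where
  "spherical_polytope W \<longleftrightarrow> (\<exists>V. spherically_generates V W)"

text \<open>
  Minimality is with respect to inclusion. The vertex set is a relation rather than a definite
  description; that it determines \<open>V\<close> from \<open>W\<close> is shown in \<open>spherical_vertex_set_unique\<close> below.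
\<close>

definition spherical_vertex_set :: "(real ^ 'n) set \<Rightarrow> (real ^ 'n) set \<Rightarrow> bool" where
  "spherical_vertex_set W V \<longleftrightarrow>
     spherically_generates V W \<and> (\<forall>V'. V' \<subset> V \<longrightarrow> \<not> spherically_generates V' W)"

definition separation_cone :: "(real ^ 'n) set \<Rightarrow> (real ^ 'n) set \<Rightarrow> (real ^ 'n) set" where
  "separation_cone W1 W2 =
     {P \<in> sphere 0 1. (\<forall>Q\<in>W1. P \<bullet> Q \<ge> 0) \<and> (\<forall>R\<in>W2. P \<bullet> R \<le> 0)}"

definition separation_center_set :: "(real ^ 'n) set \<Rightarrow> (real ^ 'n) set \<Rightarrow> (real ^ 'n) set" where
  "separation_center_set W1 W2 = separation_cone W1 W2 \<union> separation_cone W2 W1"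

lemma spherical_hull_eq_convex_hull:
  "spherical_hull W = (\<lambda>x. x /\<^sub>R norm x) ` (convex hull W)"
proof (intro subset_antisym subsetI)
  fix q assume "q \<in> spherical_hull W"
  then obtain k :: nat and l Q where
    "q = (\<Sum>i=1..k. l i *\<^sub>R Q i) /\<^sub>R norm (\<Sum>i=1..k. l i *\<^sub>R Q i)"
    "\<forall>i\<in>{1..k}. l i \<ge> 0 \<and> Q i \<in> W" "(\<Sum>i=1..k. l i) = 1"
    unfolding spherical_hull_def by blast
  moreover from this have "(\<Sum>i=1..k. l i *\<^sub>R Q i) \<in> convex hull W"
    unfolding convex_hull_indexed by blast
  ultimately show "q \<in> (\<lambda>x. x /\<^sub>R norm x) ` (convex hull W)" by blast
next
  fix q assume "q \<in> (\<lambda>x. x /\<^sub>R norm x) ` (convex hull W)"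
  then obtain x where x: "x \<in> convex hull W" "q = x /\<^sub>R norm x" by blast
  then obtain k :: nat and l Q where
    "x = (\<Sum>i=1..k. l i *\<^sub>R Q i)"
    "\<forall>i\<in>{1..k}. l i \<ge> 0 \<and> Q i \<in> W" "(\<Sum>i=1..k. l i) = 1"
    unfolding convex_hull_indexed by blast
  with x(2) show "q \<in> spherical_hull W" unfolding spherical_hull_def by blast
qed

lemma hemispherical_inner_neg:
  assumes "hemispherical W"
  obtains P where "\<And>Q. Q \<in> W \<Longrightarrow> P \<bullet> Q < 0"
proof -
  obtain P where "W \<inter> closed_hemisphere P = {}" "W \<subseteq> sphere 0 1"
    using assms unfolding hemispherical_def by auto
  then have "\<And>Q. Q \<in> W \<Longrightarrow> P \<bullet> Q < 0"
    unfolding closed_hemisphere_def by force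
  then show ?thesis using that by blast
qed

definition nonneg_span :: "(real ^ 'n) set \<Rightarrow> (real ^ 'n) set" where
  "nonneg_span V = {\<Sum>v\<in>V. a v *\<^sub>R v | a. \<forall>v\<in>V. a v \<ge> 0}"

lemma nonneg_spanI:
  assumes "x = (\<Sum>v\<in>V. a v *\<^sub>R v)" "\<And>v. v \<in> V \<Longrightarrow> a v \<ge> 0"
  shows "x \<in> nonneg_span V"
  using assms unfolding nonneg_span_def by blast

lemma nonneg_spanE:
  assumes "x \<in> nonneg_span V"
  obtains a where "x = (\<Sum>v\<in>V. a v *\<^sub>R v)" "\<forall>v\<in>V. a v \<ge> 0"
  using assms unfolding nonneg_span_def by blast

lemma nonneg_span_scale:
  assumes "x \<in> nonneg_span V" "c \<ge> 0"
  shows "c *\<^sub>R x \<in> nonneg_span V"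
proof -
  obtain a where a: "x = (\<Sum>v\<in>V. a v *\<^sub>R v)" "\<forall>v\<in>V. a v \<ge> 0"
    by (rule nonneg_spanE[OF assms(1)])
  have "c *\<^sub>R x = (\<Sum>v\<in>V. (c * a v) *\<^sub>R v)" by (simp add: a scaleR_right.sum)
  then show ?thesis by (rule nonneg_spanI) (simp add: a(2) assms(2))
qed

lemma nonneg_span_add:
  assumes "x \<in> nonneg_span V" "y \<in> nonneg_span V"
  shows "x + y \<in> nonneg_span V"
proof -
  obtain a where a: "x = (\<Sum>v\<in>V. a v *\<^sub>R v)" "\<forall>v\<in>V. a v \<ge> 0"
    by (rule nonneg_spanE[OF assms(1)])
  obtain b where b: "y = (\<Sum>v\<in>V. b v *\<^sub>R v)" "\<forall>v\<in>V. b v \<ge> 0"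
    by (rule nonneg_spanE[OF assms(2)])
  have "x + y = (\<Sum>v\<in>V. (a v + b v) *\<^sub>R v)"
    by (simp add: a b scaleR_add_left sum.distrib)
  then show ?thesis by (rule nonneg_spanI) (simp add: a(2) b(2))
qed

lemma nonneg_span_zero: "0 \<in> nonneg_span V"
  by (rule nonneg_spanI[where a = "\<lambda>v. 0"]) auto

lemma nonneg_span_sum:
  "(\<And>i. i \<in> A \<Longrightarrow> f i \<in> nonneg_span V) \<Longrightarrow> sum f A \<in> nonneg_span V"
  by (induction A rule: infinite_finite_induct) (auto intro: nonneg_span_add nonneg_span_zero)

lemma nonneg_span_mono:
  assumes "W \<subseteq> nonneg_span V"
  shows "nonneg_span W \<subseteq> nonneg_span V"
proof
  fix x assume "x \<in> nonneg_span W"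
  then obtain a where a: "x = (\<Sum>v\<in>W. a v *\<^sub>R v)" "\<forall>v\<in>W. a v \<ge> 0"
    by (auto elim!: nonneg_spanE)
  show "x \<in> nonneg_span V"
    unfolding a(1) using a(2) assms by (intro nonneg_span_sum nonneg_span_scale) auto
qed

lemma nonneg_span_base:
  assumes "finite V" "v \<in> V"
  shows "v \<in> nonneg_span V"
proof -
  have "(\<Sum>w\<in>V. (if w = v then 1 else 0) *\<^sub>R w) = (\<Sum>w\<in>V. if w = v then w else 0)"
    by (rule sum.cong) auto
  also have "\<dots> = v" using assms by simp
  finally show ?thesis by (intro nonneg_spanI[OF sym]) auto
qed

lemma spherical_hull_eq_nonneg_span:
  assumes "finite V" "hemispherical V"
  shows "spherical_hull V = nonneg_span V \<inter> sphere 0 1"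
proof (intro subset_antisym subsetI)
  fix q assume "q \<in> spherical_hull V"
  then obtain x where x: "x \<in> convex hull V" "q = x /\<^sub>R norm x"
    unfolding spherical_hull_eq_convex_hull by auto
  obtain P where P: "\<And>Q. Q \<in> V \<Longrightarrow> P \<bullet> Q < 0"
    using hemispherical_inner_neg[OF assms(2)] by blast
  have "convex hull V \<subseteq> {y. P \<bullet> y < 0}"
    by (rule hull_minimal) (auto simp: P convex_halfspace_lt)
  with x have "x \<noteq> 0" by auto
  have "x \<in> nonneg_span V"
    using x(1) unfolding convex_hull_finite[OF assms(1)] nonneg_span_def by blast
  then show "q \<in> nonneg_span V \<inter> sphere 0 1"
    using \<open>x \<noteq> 0\<close> x(2) by (auto intro!: nonneg_span_scale)
next
  fix q assume "q \<in> nonneg_span V \<inter> sphere 0 1"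
  then obtain a where a: "q = (\<Sum>v\<in>V. a v *\<^sub>R v)" "\<forall>v\<in>V. a v \<ge> 0" and q: "norm q = 1"
    by (auto elim!: nonneg_spanE)
  define s where "s = sum a V"
  have "s \<noteq> 0"
  proof
    assume "s = 0"
    then have "\<forall>v\<in>V. a v = 0"
      using a(2) assms(1) unfolding s_def by (simp add: sum_nonneg_eq_0_iff)
    then show False using a(1) q by simp
  qed
  moreover have "s \<ge> 0" unfolding s_def using a(2) by (auto intro: sum_nonneg)
  ultimately have s: "s > 0" by simp
  have "q /\<^sub>R s = (\<Sum>v\<in>V. (a v / s) *\<^sub>R v)"
    by (simp add: a(1) scaleR_right.sum divide_inverse_commute)
  moreover have "(\<Sum>v\<in>V. a v / s) = 1"
    using s by (simp add: s_def flip: sum_divide_distrib)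
  ultimately have "q /\<^sub>R s \<in> convex hull V"
    unfolding convex_hull_finite[OF assms(1)] using a(2) s
    by (intro CollectI exI[of _ "\<lambda>v. a v / s"]) auto
  moreover have "q = (q /\<^sub>R s) /\<^sub>R norm (q /\<^sub>R s)" using q s by simp
  ultimately show "q \<in> spherical_hull V" unfolding spherical_hull_eq_convex_hull by blast
qed

lemma spherical_vertex_set_subset:
  assumes "spherical_vertex_set W V" "spherically_generates V' W"
  shows "V \<subseteq> V'"
proof
  fix v assume v: "v \<in> V"
  have V: "finite V" "hemispherical V" "W = spherical_hull V"
    and min: "\<And>U. U \<subset> V \<Longrightarrow> \<not> spherically_generates U W"
    using assms(1) unfolding spherical_vertex_set_def spherically_generates_def by auto
  have V': "finite V'" "hemispherical V'" "W = spherical_hull V'"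
    using assms(2) unfolding spherically_generates_def by auto
  have sph: "V \<subseteq> sphere 0 1" "V' \<subseteq> sphere 0 1"
    using V V' unfolding hemispherical_def by auto
  have eq: "nonneg_span V \<inter> sphere 0 1 = nonneg_span V' \<inter> sphere 0 1"
    using V V' spherical_hull_eq_nonneg_span by metis
  obtain P where P: "\<And>Q. Q \<in> V \<Longrightarrow> P \<bullet> Q < 0"
    using hemispherical_inner_neg[OF V(2)] by blast
  have nv: "norm v = 1" using v sph by auto
  let ?U = "V - {v}"
  have notin: "v \<notin> nonneg_span ?U"
  proof
    assume *: "v \<in> nonneg_span ?U"
    have "?U \<noteq> {}"
    proof
      assume U: "?U = {}"
      from * have "v = 0" unfolding U nonneg_span_def by simp
      then show False using nv by simp
    qed
    have fU: "finite ?U" using V by simp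
    have hU: "hemispherical ?U" using V(2) unfolding hemispherical_def by blast
    have "V \<subseteq> nonneg_span ?U" using * nonneg_span_base[OF fU] by auto
    then have "nonneg_span V \<subseteq> nonneg_span ?U" by (rule nonneg_span_mono)
    moreover have "nonneg_span ?U \<subseteq> nonneg_span V"
      by (rule nonneg_span_mono) (use nonneg_span_base[OF V(1)] in auto)
    ultimately have "spherical_hull ?U = spherical_hull V"
      using spherical_hull_eq_nonneg_span V fU hU by (metis subset_antisym)
    then have "spherically_generates ?U W"
      unfolding spherically_generates_def using \<open>?U \<noteq> {}\<close> fU hU V by simp
    then show False using min[of ?U] v by auto
  qed
  have pointed: "P \<bullet> x \<le> 0 \<and> (P \<bullet> x = 0 \<longrightarrow> x = 0)" if x: "x \<in> nonneg_span ?U" for x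
  proof -
    obtain a where a: "x = (\<Sum>u\<in>?U. a u *\<^sub>R u)" "\<forall>u\<in>?U. a u \<ge> 0"
      by (rule nonneg_spanE[OF x])
    have Px: "- (P \<bullet> x) = (\<Sum>u\<in>?U. - (a u * (P \<bullet> u)))"
      by (simp add: a(1) inner_sum_right sum_negf)
    have nn: "\<And>u. u \<in> ?U \<Longrightarrow> 0 \<le> - (a u * (P \<bullet> u))"
      using a(2) P by (auto simp: mult_le_0_iff less_imp_le)
    have "0 \<le> - (P \<bullet> x)" unfolding Px using nn by (rule sum_nonneg)
    moreover have "x = 0" if "P \<bullet> x = 0"
    proof -
      have "(\<Sum>u\<in>?U. - (a u * (P \<bullet> u))) = 0" using Px that by simp
      then have "\<forall>u\<in>?U. - (a u * (P \<bullet> u)) = 0"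
        using nn V(1) by (subst (asm) sum_nonneg_eq_0_iff) auto
      then have "\<forall>u\<in>?U. a u = 0" using P by fastforce
      then show ?thesis unfolding a(1) by (intro sum.neutral) auto
    qed
    ultimately show ?thesis by auto
  qed
  have "v \<in> nonneg_span V'" using eq nonneg_span_base[OF V(1) v] sph v by blast
  then obtain b where b: "v = (\<Sum>w\<in>V'. b w *\<^sub>R w)" "\<forall>w\<in>V'. b w \<ge> 0"
    by (auto elim!: nonneg_spanE)
  have "\<exists>c r. w = c *\<^sub>R v + r \<and> c \<ge> 0 \<and> r \<in> nonneg_span ?U" if "w \<in> V'" for w
  proof -
    have "w \<in> nonneg_span V" using eq nonneg_span_base[OF V'(1) that] sph that by blast
    then obtain a where a: "w = (\<Sum>u\<in>V. a u *\<^sub>R u)" "\<forall>u\<in>V. a u \<ge> 0"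
      by (auto elim!: nonneg_spanE)
    have "w = a v *\<^sub>R v + (\<Sum>u\<in>?U. a u *\<^sub>R u)" using a(1) sum.remove[OF V(1) v] by metis
    moreover have "(\<Sum>u\<in>?U. a u *\<^sub>R u) \<in> nonneg_span ?U"
      unfolding nonneg_span_def using a(2) by blast
    ultimately show ?thesis using a(2) v by blast
  qed
  then obtain c r where cr: "\<And>w. w \<in> V' \<Longrightarrow> w = c w *\<^sub>R v + r w"
      "\<And>w. w \<in> V' \<Longrightarrow> c w \<ge> 0" "\<And>w. w \<in> V' \<Longrightarrow> r w \<in> nonneg_span ?U"
    by metis
  define \<alpha> where "\<alpha> = (\<Sum>w\<in>V'. b w * c w)"
  define R where "R = (\<Sum>w\<in>V'. b w *\<^sub>R r w)"
  have "(\<Sum>w\<in>V'. b w *\<^sub>R w) = (\<Sum>w\<in>V'. b w *\<^sub>R (c w *\<^sub>R v + r w))"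
    using cr(1) by (intro sum.cong) auto
  with b(1) have "v = (\<Sum>w\<in>V'. b w *\<^sub>R (c w *\<^sub>R v + r w))" by (rule trans)
  also have "\<dots> = \<alpha> *\<^sub>R v + R"
    unfolding \<alpha>_def R_def by (simp add: scaleR_add_right sum.distrib scaleR_left.sum)
  finally have vR: "v = \<alpha> *\<^sub>R v + R" .
  have br: "b w *\<^sub>R r w \<in> nonneg_span ?U" if "w \<in> V'" for w
    using that b(2) cr(3) by (auto intro: nonneg_span_scale)
  then have RU: "R \<in> nonneg_span ?U" unfolding R_def by (rule nonneg_span_sum)
  have R: "R = (1 - \<alpha>) *\<^sub>R v" unfolding scaleR_diff_left using vR by (metis add_diff_cancel_left' scaleR_one)
  have "\<alpha> \<ge> 1"
  proof (rule ccontr)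
    assume a: "\<not> \<alpha> \<ge> 1"
    have "v = (1 / (1 - \<alpha>)) *\<^sub>R R" unfolding R using a by simp
    then show False using notin nonneg_span_scale[OF RU, of "1 / (1 - \<alpha>)"] a by simp
  qed
  have "P \<bullet> R = (1 - \<alpha>) * (P \<bullet> v)"
    unfolding R by simp
  then have "P \<bullet> R \<ge> 0" using \<open>\<alpha> \<ge> 1\<close> P[OF v] by (simp add: mult_nonpos_nonpos)
  then have "(\<Sum>w\<in>V'. - (P \<bullet> (b w *\<^sub>R r w))) \<le> 0"
    unfolding R_def inner_sum_right sum_negf by simp
  moreover have nn: "\<And>w. w \<in> V' \<Longrightarrow> 0 \<le> - (P \<bullet> (b w *\<^sub>R r w))"
    using pointed[OF br] by auto
  ultimately have "(\<Sum>w\<in>V'. - (P \<bullet> (b w *\<^sub>R r w))) = 0"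
    by (meson order_antisym sum_nonneg)
  then have "\<forall>w\<in>V'. - (P \<bullet> (b w *\<^sub>R r w)) = 0"
    using sum_nonneg_eq_0_iff[OF V'(1) nn] by simp
  then have z: "\<And>w. w \<in> V' \<Longrightarrow> b w *\<^sub>R r w = 0" using pointed[OF br] by fastforce
  have "\<exists>w\<in>V'. b w \<noteq> 0"
  proof (rule ccontr)
    assume "\<not> ?thesis"
    then have "v = 0" using b(1) by simp
    then show False using nv by simp
  qed
  then obtain w where w: "w \<in> V'" "b w \<noteq> 0" by blast
  then have wv: "w = c w *\<^sub>R v" using z[OF w(1)] cr(1)[OF w(1)] by simp
  have "norm w = 1" using w sph by auto
  then have "\<bar>c w\<bar> = 1" using nv wv by (metis mult.right_neutral norm_scaleR)
  then have "c w = 1" using cr(2)[OF w(1)] by simp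
  then show "v \<in> V'" using wv w by simp
qed

theorem spherical_vertex_set_unique:
  assumes "spherical_vertex_set W V" "spherical_vertex_set W V'"
  shows "V = V'"
  using assms spherical_vertex_set_subset unfolding spherical_vertex_set_def by blast

theorem spherical_polytope_vertex_set_exists:
  assumes "spherical_polytope W"
  shows "\<exists>V. spherical_vertex_set W V"
proof -
  obtain V where V: "spherically_generates V W"
    using assms unfolding spherical_polytope_def by blast
  define n where "n = (LEAST n. \<exists>V. spherically_generates V W \<and> card V = n)"
  have "\<exists>V. spherically_generates V W \<and> card V = n"
    unfolding n_def by (rule LeastI_ex) (use V in blast)
  then obtain U where U: "spherically_generates U W" "card U = n" by blast
  have "\<not> spherically_generates V' W" if "V' \<subset> U" for V'
  proof
    assume "spherically_generates V' W"
    then have "n \<le> card V'" unfolding n_def by (intro Least_le) blast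
    moreover have "card V' < card U"
      using that U(1) by (simp add: psubset_card_mono spherically_generates_def)
    ultimately show False using U by simp
  qed
  with U show ?thesis unfolding spherical_vertex_set_def by blast
qed

end

theory Submission
  imports Defs
begin

text \<open>
  A linear functional is nonnegative on a spherical hull iff it is nonnegative on the generators.
  Reflecting the second polytope turns the two opposite sign conditions of a separation cone into
  the same one, so the separation center set only depends on the union of the two vertex sets.
\<close>

lemma inner_nonneg_spherical_hull_iff:
  assumes "V \<subseteq> sphere 0 1"
  shows "(\<forall>Q\<in>spherical_hull V. 0 \<le> X \<bullet> Q) \<longleftrightarrow> (\<forall>Q\<in>V. 0 \<le> X \<bullet> Q)"
proof
  assume "\<forall>Q\<in>spherical_hull V. 0 \<le> X \<bullet> Q"
  moreover have "V \<subseteq> spherical_hull V"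
  proof
    fix Q assume Q: "Q \<in> V"
    \<comment> \<open>Normalisation fixes unit vectors, so each generator is itself a point of the
      hull.\<close>
    then have "Q = Q /\<^sub>R norm Q" using assms by auto
    then show "Q \<in> spherical_hull V"
      unfolding spherical_hull_eq_convex_hull using Q by (blast intro: hull_inc)
  qed
  ultimately show "\<forall>Q\<in>V. 0 \<le> X \<bullet> Q" by blast
next
  assume "\<forall>Q\<in>V. 0 \<le> X \<bullet> Q"
  \<comment> \<open>A closed half-space through the origin is convex and survives normalisation: the
    factor \<open>inverse (norm y)\<close> is nonnegative, and 0 for \<open>y = 0\<close>.\<close>
  then have "convex hull V \<subseteq> {y. 0 \<le> X \<bullet> y}"
    using convex_halfspace_ge[of 0 X] by (intro hull_minimal) auto
  then show "\<forall>Q\<in>spherical_hull V. 0 \<le> X \<bullet> Q"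
    unfolding spherical_hull_eq_convex_hull by auto
qed

text \<open>Since \<open>X \<bullet> (- R) \<le> 0\<close> means
  \<open>0 \<le> X \<bullet> R\<close>, the first cone is the first disjunct; exchanging the two
  sets reverses every sign, which gives the same condition on \<open>- X\<close>.\<close>

lemma separation_center_set_spherical_hull_uminus:
  assumes "V \<subseteq> sphere 0 1" "W \<subseteq> sphere 0 1"
  shows "separation_center_set (spherical_hull V) (uminus ` spherical_hull W) =
    {X \<in> sphere 0 1. (\<forall>Q\<in>V \<union> W. 0 \<le> X \<bullet> Q) \<or> (\<forall>Q\<in>V \<union> W. 0 \<le> (- X) \<bullet> Q)}"
  \<comment> \<open>The symmetric rules turn the conditions on generators into conditions on hulls,
    so that both sides differ only in the placement of signs.\<close>
  unfolding separation_center_set_def separation_cone_def ball_Un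
    inner_nonneg_spherical_hull_iff[OF assms(1), symmetric]
    inner_nonneg_spherical_hull_iff[OF assms(2), symmetric]
  by auto

lemma spherical_vertex_setD:
  assumes "spherical_vertex_set W V"
  shows "W = spherical_hull V" "V \<subseteq> sphere 0 1"
  using assms
  unfolding spherical_vertex_set_def spherically_generates_def hemispherical_def by auto

theorem theorem5:
  fixes \<P> \<P>1 \<P>2 \<P>3 \<P>4 :: "(real ^ 'n) set"
    and P :: "nat \<Rightarrow> real ^ 'n"
    and m :: nat
    and I J I' J' :: "nat set"
  assumes "spherical_polytope \<P>"
    and "inj_on P {1..m}"
    and "spherical_vertex_set \<P> (P ` {1..m})"
    and "I \<union> J = {1..m}" and "I \<inter> J = {}" and "I \<noteq> {}" and "J \<noteq> {}"
    and "I' \<union> J' = {1..m}" and "I' \<inter> J' = {}" and "I' \<noteq> {}" and "J' \<noteq> {}"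
    and "spherical_polytope \<P>1" and "spherical_vertex_set \<P>1 (P ` I)"
    and "spherical_polytope \<P>2" and "spherical_vertex_set \<P>2 (P ` J)"
    and "spherical_polytope \<P>3" and "spherical_vertex_set \<P>3 (P ` I')"
    and "spherical_polytope \<P>4" and "spherical_vertex_set \<P>4 (P ` J')"
    and "\<P>1 \<inter> (uminus ` \<P>2) = {}"
    and "\<P>3 \<inter> (uminus ` \<P>4) = {}"
  shows "separation_center_set \<P>1 (uminus ` \<P>2) = separation_center_set \<P>3 (uminus ` \<P>4)"
proof -
  \<comment> \<open>The right-hand side mentions neither \<open>K\<close> nor \<open>L\<close>, so
    both partitions give the same set.\<close>
  have center: "separation_center_set A (uminus ` B) =
      {X \<in> sphere 0 1. (\<forall>Q\<in>P ` {1..m}. 0 \<le> X \<bullet> Q) \<or> (\<forall>Q\<in>P ` {1..m}. 0 \<le> (- X) \<bullet> Q)}"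
    if "spherical_vertex_set A (P ` K)" "spherical_vertex_set B (P ` L)" "K \<union> L = {1..m}"
    for A B K L
    using separation_center_set_spherical_hull_uminus[of "P ` K" "P ` L"]
      spherical_vertex_setD[OF that(1)] spherical_vertex_setD[OF that(2)]
    by (simp only: that(3) image_Un[symmetric])
  show ?thesis
    using center[of \<P>1 I \<P>2 J] center[of \<P>3 I' \<P>4 J'] assms by (simp only:)
qed

end
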